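(* Consider the Gaussian white noise model with the Poisson–Gaussian sieve prior described in the context, with scale exponent $q$, and let $\hat{\boldsymbol\theta}_n$ be the posterior mean. If the point $t$ is such that $a_j=\psi_j(t)=1$ for all $j$ ($t=0$), then for all $\beta\ge q$ and all $L_0>0$, a lower bound on the risk rate under pointwise loss is given by $$\sup_{\boldsymbol\theta_0\in\Theta_\beta(L_0)}R_n^{\mathrm{loc}}(\boldsymbol\theta_0,t)\ \gtrsim\ \frac{n^{-\frac{2\beta-1}{2\beta+1}}}{\log^2n},$$ i.e. the left-hand side is at least a positive constant (independent of $n$) times the right-hand side for all large $n$.
   Context: White noise model. One observes $dX^n(t)=\boldsymbol f_0(t)dt+n^{-1/2}dW(t)$, $0\le t\le1$, with $\boldsymbol f_0\in L^2(0,1)$ and $W$ a standard Brownian motion; equivalently, with $\boldsymbol\psi=(\psi_j)_{j\ge1}$ a Fourier basis of $L^2(0,1)$, one observes $X_j^n=\theta_{0j}+\frac{1}{\sqrt n}\xi_j$, $j\ge1$, with independent standard Gaussian $\xi_j$ and $\boldsymbol f_0=\sum_j\theta_{0j}\psi_j$. $\mathbb{E}_0^{(n)}$ is the expectation under $\boldsymbol\theta_0=(\theta_{0j})_{j\ge1}$. Sobolev classes. $\Theta_\beta(L_0)=\{\boldsymbol\theta:\sum_{j\ge1}\theta_j^2j^{2\beta}<L_0\}$, $\beta>1/2$, $L_0>0$. Prior. $k\sim\mathrm{Poisson}(\lambda)$ with fixed $\lambda>0$; given $k$, the variables $\theta_j/\tau_j$, $j=1,\ldots,k$, are independent $\mathcal{N}(0,1)$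 and $\theta_j=0$ for $j>k$; the scales are $\tau_j^2=\tau_0j^{-2q}$ with $\tau_0>0$ and $1/2<q\le1$. $\hat{\boldsymbol\theta}_n=(\hat\theta_{nj})_{j\ge1}$ is the posterior mean of $\boldsymbol\theta$ given $X^n$. Pointwise risk. With $\hat{\boldsymbol f}_n=\sum_j\hat\theta_{nj}\psi_j$ and $a_j=\psi_j(t)$, $R_n^{\mathrm{loc}}(\boldsymbol\theta_0,t)=\mathbb{E}_0^{(n)}\big(\hat{\boldsymbol f}_n(t)-\boldsymbol f_0(t)\big)^2=\mathbb{E}_0^{(n)}\Big(\sum_{j\ge1}a_j(\hat\theta_{nj}-\theta_{0j})\Big)^2$. *)

theory Defs
  imports "HOL-Probability.Probability"
begin

text \<open>
  Sequences \<open>(x\<^sub>j)\<^sub>j\<^sub>\<ge>\<^sub>1\<close> are functions of type \<^typ>\<open>nat \<Rightarrow> real\<close>; the value at \<open>0\<close> is irrelevant. Random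
  sequences live in the product space over the index set \<open>{1..}\<close>, and series over
  \<open>j \<ge> 1\<close> are written with index \<open>Suc j\<close>, in the natural order of summation.
\<close>

definition seq_space :: "(nat \<Rightarrow> real) measure" where
  "seq_space = PiM {1..} (\<lambda>_. borel)"

definition gauss_seq :: "(nat \<Rightarrow> real) measure" where
  "gauss_seq = PiM {1..} (\<lambda>_. std_normal_distribution)"


subsection \<open>White noise model in sequence form\<close>

definition noisy :: "nat \<Rightarrow> (nat \<Rightarrow> real) \<Rightarrow> (nat \<Rightarrow> real) \<Rightarrow> (nat \<Rightarrow> real)" where
  "noisy n \<theta> \<xi> = (\<lambda>j\<in>{1..}. \<theta> j + \<xi> j / sqrt (real n))"

definition obs_law :: "nat \<Rightarrow> (nat \<Rightarrow> real) \<Rightarrow> (nat \<Rightarrow> real) measure" where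
  "obs_law n \<theta> = distr gauss_seq seq_space (noisy n \<theta>)"

definition sobolev :: "real \<Rightarrow> real \<Rightarrow> (nat \<Rightarrow> real) set" where
  "sobolev \<beta> L =
    {\<theta>. summable (\<lambda>j. (\<theta> (Suc j))\<^sup>2 * real (Suc j) powr (2 * \<beta>)) \<and>
        (\<Sum>j. (\<theta> (Suc j))\<^sup>2 * real (Suc j) powr (2 * \<beta>)) < L}"


subsection \<open>Sieve prior and posterior mean\<close>

text \<open>The scales satisfy \<open>\<tau>\<^sub>j\<^sup>2 = \<tau>\<^sub>0 j\<^sup>-\<^sup>2\<^sup>q\<close>, so \<open>\<tau>\<^sub>0\<close> is a variance.\<close>

definition scale :: "real \<Rightarrow> real \<Rightarrow> nat \<Rightarrow> real" where
  "scale \<tau>0 q j = sqrt (\<tau>0 * real j powr (- 2 * q))"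

definition sieve :: "real \<Rightarrow> real \<Rightarrow> nat \<Rightarrow> (nat \<Rightarrow> real) \<Rightarrow> (nat \<Rightarrow> real)" where
  "sieve \<tau>0 q k z = (\<lambda>j\<in>{1..}. if j \<le> k then scale \<tau>0 q j * z j else 0)"

definition prior :: "real \<Rightarrow> real \<Rightarrow> real \<Rightarrow> (nat \<Rightarrow> real) measure" where
  "prior lam \<tau>0 q =
     distr (measure_pmf (poisson_pmf lam) \<Otimes>\<^sub>M gauss_seq) seq_space (\<lambda>(k, z). sieve \<tau>0 q k z)"

text \<open>Joint law of the pair (parameter, observation) in the Bayesian model; the noise is
  independent of the parameter.\<close>

definition joint_law ::
    "real \<Rightarrow> real \<Rightarrow> real \<Rightarrow> nat \<Rightarrow> ((nat \<Rightarrow> real) \<times> (nat \<Rightarrow> real)) measure" where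
  "joint_law lam \<tau>0 q n =
     distr (prior lam \<tau>0 q \<Otimes>\<^sub>M gauss_seq) (seq_space \<Otimes>\<^sub>M seq_space)
       (\<lambda>(\<theta>, \<xi>). (\<theta>, noisy n \<theta> \<xi>))"

text \<open>\<open>h\<close>, as a function of the observed sequence, is a version of the posterior mean:
  \<open>h x j = E(\<theta>\<^sub>j | X = x)\<close>. Versions agree up to null sets of the marginal law of \<open>X\<close>; these are also
  null sets of \<open>obs_law n \<theta>\<close> for every square-summable \<open>\<theta>\<close> (if \<open>n \<ge> 1\<close>), so that risks at
  such \<open>\<theta>\<close> do not depend on the version.\<close>

definition posterior_mean ::
    "real \<Rightarrow> real \<Rightarrow> real \<Rightarrow> nat \<Rightarrow> ((nat \<Rightarrow> real) \<Rightarrow> (nat \<Rightarrow> real)) \<Rightarrow> bool" where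
  "posterior_mean lam \<tau>0 q n h \<longleftrightarrow>
     (\<forall>j\<ge>1. (\<lambda>x. h x j) \<in> borel_measurable seq_space \<and>
       (let J = joint_law lam \<tau>0 q n in
        AE \<omega> in J. h (snd \<omega>) j =
          real_cond_exp J (vimage_algebra (space J) snd seq_space) (\<lambda>\<omega>. fst \<omega> j) \<omega>))"


subsection \<open>Bases of \<open>L\<^sup>2(0,1)\<close> and pointwise risk\<close>

definition square_integrable :: "(real \<Rightarrow> real) \<Rightarrow> bool" where
  "square_integrable f \<longleftrightarrow>
     f \<in> borel_measurable (lebesgue_on {0<..<1}) \<and>
     integrable (lebesgue_on {0<..<1}) (\<lambda>s. (f s)\<^sup>2)"

definition L2_inner :: "(real \<Rightarrow> real) \<Rightarrow> (real \<Rightarrow> real) \<Rightarrow> real" where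
  "L2_inner f g = (LINT s|lebesgue_on {0<..<1}. f s * g s)"

text \<open>Real-valued orthonormal bases with \<open>\<psi>\<^sub>j(0) = 1\<close> for all \<open>j\<close> exist, for instance the Fourier
  basis consisting of \<open>s \<mapsto> cos(2\<pi>ms) + sin(2\<pi>ms)\<close> for integer \<open>m\<close>.\<close>

definition orthonormal_basis_L2 :: "(nat \<Rightarrow> real \<Rightarrow> real) \<Rightarrow> bool" where
  "orthonormal_basis_L2 \<psi> \<longleftrightarrow>
     (\<forall>j\<ge>1. square_integrable (\<psi> j)) \<and>
     (\<forall>i\<ge>1. \<forall>j\<ge>1. L2_inner (\<psi> i) (\<psi> j) = (if i = j then 1 else 0)) \<and>
     (\<forall>f. square_integrable f \<longrightarrow>
        (\<lambda>N. LINT s|lebesgue_on {0<..<1}. (f s - (\<Sum>j=1..N. L2_inner f (\<psi> j) * \<psi> j s))\<^sup>2)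
          \<longlonglongrightarrow> 0)"

definition expansion :: "(nat \<Rightarrow> real \<Rightarrow> real) \<Rightarrow> (nat \<Rightarrow> real) \<Rightarrow> real \<Rightarrow> real" where
  "expansion \<psi> \<theta> t = (\<Sum>j. \<theta> (Suc j) * \<psi> (Suc j) t)"

definition local_risk ::
    "(nat \<Rightarrow> real \<Rightarrow> real) \<Rightarrow> nat \<Rightarrow> ((nat \<Rightarrow> real) \<Rightarrow> (nat \<Rightarrow> real)) \<Rightarrow> (nat \<Rightarrow> real) \<Rightarrow> real \<Rightarrow> ennreal" where
  "local_risk \<psi> n h \<theta> t =
     (\<integral>\<^sup>+ x. ennreal ((expansion \<psi> (h x) t - expansion \<psi> \<theta> t)\<^sup>2) \<partial>obs_law n \<theta>)"

end

theory Submission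
  imports Defs "HOL-Real_Asymp.Real_Asymp"
begin

text \<open>
  The posterior mean loses because it cannot see a block of coefficients at indices beyond
  \<open>K = n\<^bsup>1/(2\<beta>+1)\<^esup>\<close> (up to a constant) as long as each of them has the size \<open>1 / \<surd>n\<close> of the
  noise. Every such coefficient is hidden individually, and the block fits into the Sobolev ball,
  but at a point where all basis functions equal \<open>1\<close> the coefficients add up coherently to
  \<open>F = K / \<surd>n\<close>, whose square is of the order \<open>n\<^bsup>-(2\<beta>-1)/(2\<beta>+1)\<^esup>\<close>.

  To make this rigorous without computing the posterior, the two parameters with coefficients
  \<open>\<plusminus>1 / \<surd>n\<close> on the block \<open>{K<..2K}\<close> and \<open>0\<close> elsewhere are played against each other
  (\<open>local_risk_two_point\<close>). The values of the target at them differ by \<open>2F\<close>, while the estimator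
  takes nearly the same value under both, for two reasons.

  \<^item> Let \<open>flip K\<close> change the sign of all coordinates beyond \<open>K\<close>. The prior and the noise are
    symmetric, so the Bayesian joint law is invariant when parameter and observation are flipped
    together. Hence the posterior means of the first \<open>K\<close> coefficients do not change when the
    observation is flipped (\<open>posterior_mean_flip\<close>). On the other hand, the flip turns the law of the
    data under one of the two parameters into the law under the other.

  \<^item> The posterior means of the coefficients beyond \<open>K\<close> are negligible. In the Bayesian model they
    are bounded in \<open>L\<^sup>1\<close> by the prior size of these coefficients, which decays faster than any
    exponential since \<open>k\<close> is Poisson (\<open>joint_law_abs_parameter\<close>). The data law under the zero
    parameter is dominated by the Bayesian marginal, because \<open>k = 0\<close> has positive prior
    probability (\<open>obs_law_zero_le_marginal\<close>). Passing from the zero parameter to the two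
    alternatives costs at most a factor of the order \<open>exp K\<close>, the second moment of the
    likelihood ratio (\<open>gauss_seq_translate_event\<close>), and the decay beats this factor.

  So the sum of the two risks is at least a constant times \<open>F\<^sup>2\<close>.
\<close>

section \<open>The Gaussian sequence\<close>

lemma sets_gauss_seq [measurable_cong, simp]: "sets gauss_seq = sets seq_space"
  unfolding gauss_seq_def seq_space_def by (intro sets_PiM_cong) auto

lemma space_gauss_seq [simp]: "space gauss_seq = space seq_space"
  by (rule sets_eq_imp_space_eq) simp

lemma prob_space_std_normal: "prob_space std_normal_distribution"
  by (rule prob_space_normal_density) simp

lemma prob_space_gauss_seq: "prob_space gauss_seq"
  unfolding gauss_seq_def by (intro prob_space_PiM prob_space_std_normal)

lemma measurable_seq_component [measurable]:
  assumes "1 \<le> j" shows "(\<lambda>x. x j) \<in> borel_measurable seq_space"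
  unfolding seq_space_def using assms by (intro measurable_component_singleton) auto

lemma measurable_seq_component_comp [measurable (raw)]:
  assumes "f \<in> measurable M seq_space" "1 \<le> j" shows "(\<lambda>x. f x j) \<in> borel_measurable M"
  using assms by (rule measurable_compose[OF _ measurable_seq_component])

lemma measurable_into_seq_space:
  assumes "\<And>j. 1 \<le> j \<Longrightarrow> (\<lambda>x. f x j) \<in> borel_measurable M"
    and "\<And>x. x \<in> space M \<Longrightarrow> f x 0 = undefined"
  shows "f \<in> measurable M seq_space"
proof -
  have "(\<lambda>x. \<lambda>j\<in>{1..}. f x j) \<in> measurable M seq_space"
    unfolding seq_space_def using assms(1) by (intro measurable_restrict) auto
  moreover have "(\<lambda>j\<in>{1..}. f x j) = f x" if "x \<in> space M" for x
    using assms(2)[OF that] by (auto simp: restrict_def fun_eq_iff not_less_eq_eq)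
  ultimately show ?thesis by (subst measurable_cong[where g = "\<lambda>x. \<lambda>j\<in>{1..}. f x j"]) auto
qed

lemma space_seq_space_iff: "x \<in> space seq_space \<longleftrightarrow> x 0 = undefined"
  by (auto simp: seq_space_def space_PiM PiE_def extensional_def not_less_eq_eq)

lemma distr_PiM_componentwise:
  assumes M: "\<And>i. i \<in> I \<Longrightarrow> prob_space (M i)"
    and f: "\<And>i. i \<in> I \<Longrightarrow> f i \<in> measurable (M i) (M i)"
    and inv: "\<And>i. i \<in> I \<Longrightarrow> distr (M i) (M i) (f i) = M i"
  shows "distr (PiM I M) (PiM I M) (\<lambda>z. \<lambda>i\<in>I. f i (z i)) = PiM I M"
proof (rule measure_eqI_PiM_infinite[symmetric, OF refl])
  interpret prob_space "PiM I M" using M by (rule prob_space_PiM)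
  show "finite_measure (PiM I M)" by unfold_locales
  have meas: "(\<lambda>z. \<lambda>i\<in>I. f i (z i)) \<in> measurable (PiM I M) (PiM I M)"
    using f by (intro measurable_restrict measurable_compose[OF measurable_component_singleton]) auto
  fix A J assume J: "finite J" "J \<subseteq> I" and A: "\<And>i. i \<in> J \<Longrightarrow> A i \<in> sets (M i)"
  have "(\<lambda>z. \<lambda>i\<in>I. f i (z i)) -` prod_emb I M J (Pi\<^sub>E J A) \<inter> space (PiM I M)
      = prod_emb I M J (\<Pi>\<^sub>E i\<in>J. f i -` A i \<inter> space (M i))"
    using J measurable_space[OF f] by (auto simp: prod_emb_def space_PiM PiE_iff subset_eq)
  then have "emeasure (distr (PiM I M) (PiM I M) (\<lambda>z. \<lambda>i\<in>I. f i (z i))) (prod_emb I M J (Pi\<^sub>E J A))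
      = emeasure (PiM I M) (prod_emb I M J (\<Pi>\<^sub>E i\<in>J. f i -` A i \<inter> space (M i)))"
    using meas J A by (subst emeasure_distr) (auto intro!: sets_PiM_I)
  also have "\<dots> = (\<Prod>i\<in>J. emeasure (M i) (f i -` A i \<inter> space (M i)))"
    using J A M f by (intro emeasure_PiM_emb) (auto intro!: measurable_sets)
  also have "\<dots> = (\<Prod>i\<in>J. emeasure (M i) (A i))"
  proof (intro prod.cong refl)
    fix i assume "i \<in> J"
    then have "emeasure (distr (M i) (M i) (f i)) (A i) = emeasure (M i) (f i -` A i \<inter> space (M i))"
      using J f A by (intro emeasure_distr) auto
    then show "emeasure (M i) (f i -` A i \<inter> space (M i)) = emeasure (M i) (A i)"
      using \<open>i \<in> J\<close> J inv by auto
  qed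
  also have "\<dots> = emeasure (PiM I M) (prod_emb I M J (Pi\<^sub>E J A))"
    using J A M by (intro emeasure_PiM_emb[symmetric]) auto
  finally show "emeasure (PiM I M) (prod_emb I M J (Pi\<^sub>E J A)) =
    emeasure (distr (PiM I M) (PiM I M) (\<lambda>z. \<lambda>i\<in>I. f i (z i))) (prod_emb I M J (Pi\<^sub>E J A))" ..
qed simp

lemma std_normal_symmetric: "distr std_normal_distribution std_normal_distribution uminus = std_normal_distribution"
proof (rule measure_eqI)
  fix A :: "real set" assume "A \<in> sets (distr std_normal_distribution std_normal_distribution uminus)"
  then have [measurable]: "A \<in> sets borel" by simp
  have "emeasure (distr std_normal_distribution std_normal_distribution uminus) A
      = (\<integral>\<^sup>+x. ennreal (std_normal_density x) * indicator A (- x) \<partial>lborel)"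
    using measurable_sets[OF borel_measurable_uminus[OF measurable_ident], of A]
    by (subst emeasure_distr) (auto simp: emeasure_density intro!: nn_integral_cong split: split_indicator)
  also have "\<dots> = (\<integral>\<^sup>+x. ennreal (std_normal_density x) * indicator A x \<partial>lborel)"
    by (subst nn_integral_real_affine[where c = "-1" and t = 0])
       (auto simp: std_normal_density_def)
  also have "\<dots> = emeasure std_normal_distribution A"
    by (subst emeasure_density) auto
  finally show "emeasure (distr std_normal_distribution std_normal_distribution uminus) A
    = emeasure std_normal_distribution A" .
qed simp

subsection \<open>Flipping the signs of high coordinates\<close>

definition flip :: "nat \<Rightarrow> (nat \<Rightarrow> real) \<Rightarrow> (nat \<Rightarrow> real)" where
  "flip K x = (\<lambda>j\<in>{1..}. if K < j then - x j else x j)"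

lemma measurable_flip [measurable]: "flip K \<in> measurable seq_space seq_space"
  by (intro measurable_into_seq_space) (auto simp: flip_def)

lemma flip_apply: "1 \<le> j \<Longrightarrow> flip K x j = (if K < j then - x j else x j)"
  by (simp add: flip_def)

lemma flip_flip: "x \<in> space seq_space \<Longrightarrow> flip K (flip K x) = x"
  by (auto simp: flip_def space_seq_space_iff fun_eq_iff restrict_def not_less_eq_eq)

lemma gauss_seq_flip: "distr gauss_seq seq_space (flip K) = gauss_seq"
proof -
  have "distr gauss_seq seq_space (flip K) = distr gauss_seq gauss_seq (flip K)"
    by (intro distr_cong) auto
  also have "\<dots> = distr gauss_seq gauss_seq (\<lambda>z. \<lambda>j\<in>{1..}. (if K < j then uminus else (\<lambda>x. x)) (z j))"
    by (intro arg_cong[where f = "distr gauss_seq gauss_seq"]) (auto simp: flip_def fun_eq_iff)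
  also have "\<dots> = gauss_seq"
    unfolding gauss_seq_def
    by (intro distr_PiM_componentwise)
       (auto simp: std_normal_symmetric prob_space_std_normal
             intro!: distr_id2 simp del: distr_id)
  finally show ?thesis .
qed

subsection \<open>Translating finitely many coordinates\<close>

lemma std_normal_translate:
  assumes [measurable]: "g \<in> borel_measurable borel"
  shows "(\<integral>\<^sup>+x. g (x + b) \<partial>std_normal_distribution)
    = (\<integral>\<^sup>+x. g x * ennreal (exp (b * x - b\<^sup>2 / 2)) \<partial>std_normal_distribution)"
proof -
  have "(\<integral>\<^sup>+x. g (x + b) \<partial>std_normal_distribution)
      = (\<integral>\<^sup>+x. ennreal (std_normal_density x) * g (x + b) \<partial>lborel)"
    by (subst nn_integral_density) auto
  also have "\<dots> = (\<integral>\<^sup>+x. ennreal (std_normal_density (x - b)) * g x \<partial>lborel)"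
    by (subst nn_integral_real_affine[where c = 1 and t = "- b"]) (auto simp: add.commute)
  also have "\<dots> = (\<integral>\<^sup>+x. ennreal (std_normal_density x) * (g x * ennreal (exp (b * x - b\<^sup>2 / 2))) \<partial>lborel)"
  proof (intro nn_integral_cong)
    fix x :: real
    have "- (x - b)\<^sup>2 / 2 = - x\<^sup>2 / 2 + (b * x - b\<^sup>2 / 2)"
      by (simp add: power2_eq_square field_simps)
    then have "std_normal_density (x - b) = std_normal_density x * exp (b * x - b\<^sup>2 / 2)"
      unfolding std_normal_density_def by (simp flip: exp_add)
    then have "ennreal (std_normal_density (x - b))
        = ennreal (std_normal_density x) * ennreal (exp (b * x - b\<^sup>2 / 2))"
      by (simp add: ennreal_mult')
    then show "ennreal (std_normal_density (x - b)) * g x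
        = ennreal (std_normal_density x) * (g x * ennreal (exp (b * x - b\<^sup>2 / 2)))"
      by (simp add: mult_ac)
  qed
  also have "\<dots> = (\<integral>\<^sup>+x. g x * ennreal (exp (b * x - b\<^sup>2 / 2)) \<partial>std_normal_distribution)"
    by (subst nn_integral_density) auto
  finally show ?thesis .
qed

definition translate :: "nat set \<Rightarrow> real \<Rightarrow> (nat \<Rightarrow> real) \<Rightarrow> (nat \<Rightarrow> real)" where
  "translate I b z = (\<lambda>j. z j + (if j \<in> I then b else 0))"

lemma measurable_translate [measurable]:
  assumes "I \<subseteq> {1..}" shows "translate I b \<in> measurable seq_space seq_space"
  using assms
  by (intro measurable_into_seq_space) (auto simp: translate_def space_seq_space_iff)

text \<open>Resampling one coordinate independently leaves the law unchanged. This isolates a coordinate,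
  so that the one-dimensional translation formula can be applied to it.\<close>

lemma nn_integral_gauss_seq_coordinate:
  assumes j: "1 \<le> j" and [measurable]: "g \<in> borel_measurable seq_space"
  shows "(\<integral>\<^sup>+z. g z \<partial>gauss_seq)
    = (\<integral>\<^sup>+z. (\<integral>\<^sup>+x. g (z(j := x)) \<partial>std_normal_distribution) \<partial>gauss_seq)"
proof -
  interpret N: prob_space std_normal_distribution by (rule prob_space_std_normal)
  interpret G: prob_space gauss_seq by (rule prob_space_gauss_seq)
  interpret P: pair_sigma_finite std_normal_distribution gauss_seq ..
  have upd [measurable]: "(\<lambda>p. (snd p)(j := fst p)) \<in> measurable (std_normal_distribution \<Otimes>\<^sub>M gauss_seq) seq_space"
  proof (intro measurable_into_seq_space)
    fix i :: nat assume "1 \<le> i"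
    then show "(\<lambda>p. ((snd p)(j := fst p)) i) \<in> borel_measurable (std_normal_distribution \<Otimes>\<^sub>M gauss_seq)"
      by (cases "i = j") auto
  qed (use j in \<open>auto simp: space_pair_measure space_seq_space_iff\<close>)
  have "gauss_seq = distr (std_normal_distribution \<Otimes>\<^sub>M gauss_seq) gauss_seq (\<lambda>(x, z). z(j := x))"
    using distr_pair_PiM_eq_PiM[of "{1..}" "\<lambda>_. std_normal_distribution" j] j
    by (simp add: gauss_seq_def prob_space_std_normal insert_absorb)
  also have "\<dots> = distr (std_normal_distribution \<Otimes>\<^sub>M gauss_seq) seq_space (\<lambda>p. (snd p)(j := fst p))"
    by (intro distr_cong) (auto simp: case_prod_beta)
  finally have "(\<integral>\<^sup>+z. g z \<partial>gauss_seq)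
      = (\<integral>\<^sup>+z. g z \<partial>distr (std_normal_distribution \<Otimes>\<^sub>M gauss_seq) seq_space (\<lambda>p. (snd p)(j := fst p)))"
    by simp
  also have "\<dots> = (\<integral>\<^sup>+p. g ((snd p)(j := fst p)) \<partial>(std_normal_distribution \<Otimes>\<^sub>M gauss_seq))"
    by (intro nn_integral_distr) auto
  also have "\<dots> = (\<integral>\<^sup>+z. (\<integral>\<^sup>+x. g (z(j := x)) \<partial>std_normal_distribution) \<partial>gauss_seq)"
    by (subst P.nn_integral_snd[symmetric]) auto
  finally show ?thesis .
qed

text \<open>The Cameron--Martin formula for directions of finite support.\<close>

lemma gauss_seq_translate:
  assumes "finite I" "I \<subseteq> {1..}" and "f \<in> borel_measurable seq_space"
  shows "(\<integral>\<^sup>+z. f (translate I b z) \<partial>gauss_seq)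
    = (\<integral>\<^sup>+z. f z * ennreal (exp (\<Sum>i\<in>I. b * z i - b\<^sup>2 / 2)) \<partial>gauss_seq)"
  using assms
proof (induction I arbitrary: f rule: finite_induct)
  case empty
  then show ?case by (simp add: translate_def)
next
  case (insert j I)
  note [measurable] = insert.prems(2)
  have j: "1 \<le> j" and I: "I \<subseteq> {1..}" using insert.prems by auto
  note [measurable] = measurable_translate[OF I] measurable_seq_component[OF j]
  have tr: "translate {j} b \<in> measurable seq_space seq_space"
    by (rule measurable_translate) (use j in auto)
  note [measurable] = tr
  have meas_sum [measurable]: "(\<lambda>z. \<Sum>i\<in>I. b * z i - b\<^sup>2 / 2) \<in> borel_measurable seq_space"
    using I by (intro borel_measurable_sum) (auto intro!: borel_measurable_diff borel_measurable_times measurable_seq_component)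
  have one: "(\<integral>\<^sup>+z. g (translate {j} b z) \<partial>gauss_seq)
      = (\<integral>\<^sup>+z. g z * ennreal (exp (b * z j - b\<^sup>2 / 2)) \<partial>gauss_seq)"
    if [measurable]: "g \<in> borel_measurable seq_space" for g
  proof -
    have "(\<integral>\<^sup>+z. g (translate {j} b z) \<partial>gauss_seq)
        = (\<integral>\<^sup>+z. (\<integral>\<^sup>+x. g (translate {j} b (z(j := x))) \<partial>std_normal_distribution) \<partial>gauss_seq)"
      by (rule nn_integral_gauss_seq_coordinate[OF j]) measurable
    also have "\<dots> = (\<integral>\<^sup>+z. (\<integral>\<^sup>+x. g (z(j := x + b)) \<partial>std_normal_distribution) \<partial>gauss_seq)"
      by (intro nn_integral_cong arg_cong[where f = g]) (auto simp: translate_def fun_eq_iff)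
    also have "\<dots> = (\<integral>\<^sup>+z. (\<integral>\<^sup>+x. g (z(j := x)) * ennreal (exp (b * x - b\<^sup>2 / 2)) \<partial>std_normal_distribution) \<partial>gauss_seq)"
    proof (rule nn_integral_cong, rule std_normal_translate[where g = "\<lambda>x. g (z(j := x))" for z])
      fix z assume "z \<in> space gauss_seq"
      then have "(\<lambda>x. z(j := x)) \<in> measurable borel seq_space"
        using j by (intro measurable_into_seq_space) (auto simp: space_seq_space_iff fun_upd_def)
      then show "(\<lambda>x. g (z(j := x))) \<in> borel_measurable borel"
        by (rule measurable_compose) (rule that)
    qed
    also have "\<dots> = (\<integral>\<^sup>+z. g z * ennreal (exp (b * z j - b\<^sup>2 / 2)) \<partial>gauss_seq)"
      by (subst nn_integral_gauss_seq_coordinate[OF j]) auto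
    finally show ?thesis .
  qed
  have comp: "translate (insert j I) b z = translate I b (translate {j} b z)" for z
    using insert.hyps by (auto simp: translate_def fun_eq_iff)
  have "(\<integral>\<^sup>+z. f (translate (insert j I) b z) \<partial>gauss_seq)
      = (\<integral>\<^sup>+z. f (translate I b z) * ennreal (exp (b * z j - b\<^sup>2 / 2)) \<partial>gauss_seq)"
    unfolding comp by (rule one) measurable
  also have "\<dots> = (\<integral>\<^sup>+z. f (translate I b z) * ennreal (exp (b * translate I b z j - b\<^sup>2 / 2)) \<partial>gauss_seq)"
    using insert.hyps by (simp add: translate_def)
  also have "\<dots> = (\<integral>\<^sup>+z. (f z * ennreal (exp (b * z j - b\<^sup>2 / 2))) * ennreal (exp (\<Sum>i\<in>I. b * z i - b\<^sup>2 / 2)) \<partial>gauss_seq)"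
    by (rule insert.IH[OF I]) measurable
  also have "\<dots> = (\<integral>\<^sup>+z. f z * ennreal (exp (\<Sum>i\<in>insert j I. b * z i - b\<^sup>2 / 2)) \<partial>gauss_seq)"
    using insert.hyps by (simp add: exp_add ennreal_mult mult_ac)
  finally show ?case .
qed

text \<open>The likelihood ratio \<open>L\<close> of the translated law has second moment \<open>exp (b\<^sup>2 |I|)\<close>: its square is
  this constant times the likelihood ratio for the translation by \<open>2b\<close>. The bound is the
  Cauchy--Schwarz inequality for \<open>L\<close> and the indicator of \<open>A\<close>, in its additive form with a free
  parameter \<open>e\<close>, which avoids square roots.\<close>

lemma gauss_seq_translate_event:
  assumes I: "finite I" "I \<subseteq> {1..}" and [measurable]: "A \<in> sets seq_space" and e: "e > 0"
  shows "(\<integral>\<^sup>+z. indicator A (translate I b z) \<partial>gauss_seq)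
    \<le> ennreal e + ennreal (exp (b\<^sup>2 * card I) / (4 * e)) * emeasure gauss_seq A"
proof -
  interpret G: prob_space gauss_seq by (rule prob_space_gauss_seq)
  define m where "m = exp (b\<^sup>2 * card I)"
  have m: "m > 0" by (simp add: m_def)
  define L where "L z = exp (\<Sum>i\<in>I. b * z i - b\<^sup>2 / 2)" for z :: "nat \<Rightarrow> real"
  have meas [measurable]: "(\<lambda>z. \<Sum>i\<in>I. c * z i - d) \<in> borel_measurable seq_space" for c d
    using I by (intro borel_measurable_sum) (auto intro!: borel_measurable_diff borel_measurable_times measurable_seq_component)
  have Lm [measurable]: "L \<in> borel_measurable seq_space" unfolding L_def by measurable
  have L2: "(\<integral>\<^sup>+z. ennreal ((L z)\<^sup>2) \<partial>gauss_seq) = ennreal m"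
  proof -
    have *: "(L z)\<^sup>2 = m * exp (\<Sum>i\<in>I. (2 * b) * z i - (2 * b)\<^sup>2 / 2)" for z
      unfolding L_def m_def exp_add[symmetric] exp_double[symmetric]
      by (simp add: sum_distrib_left sum_subtractf algebra_simps power2_eq_square)
    have "(\<integral>\<^sup>+z. ennreal ((L z)\<^sup>2) \<partial>gauss_seq)
        = ennreal m * (\<integral>\<^sup>+z. 1 * ennreal (exp (\<Sum>i\<in>I. (2 * b) * z i - (2 * b)\<^sup>2 / 2)) \<partial>gauss_seq)"
      unfolding * using m by (subst nn_integral_cmult[symmetric]) (auto simp: ennreal_mult)
    also have "(\<integral>\<^sup>+z. 1 * ennreal (exp (\<Sum>i\<in>I. (2 * b) * z i - (2 * b)\<^sup>2 / 2)) \<partial>gauss_seq) = 1"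
      by (subst gauss_seq_translate[OF I, symmetric, where f = "\<lambda>_. 1"]) (use G.emeasure_space_1 in auto)
    finally show ?thesis by simp
  qed
  have "(\<integral>\<^sup>+z. indicator A (translate I b z) \<partial>gauss_seq)
      = (\<integral>\<^sup>+z. indicator A z * ennreal (L z) \<partial>gauss_seq)"
    unfolding L_def by (rule gauss_seq_translate[OF I]) measurable
  also have "\<dots> \<le> (\<integral>\<^sup>+z. ennreal (e / m) * ennreal ((L z)\<^sup>2) + ennreal (m / (4 * e)) * indicator A z \<partial>gauss_seq)"
  proof (intro nn_integral_mono)
    fix z :: "nat \<Rightarrow> real"
    \<comment> \<open>AM--GM, weighted so that the first term integrates to \<open>e\<close>\<close>
    have "0 \<le> (2 * e * L z - m)\<^sup>2" by simp
    then have "4 * e * m * L z \<le> 4 * e\<^sup>2 * (L z)\<^sup>2 + m\<^sup>2"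
      by (simp add: power2_eq_square algebra_simps)
    then have "L z \<le> e / m * (L z)\<^sup>2 + m / (4 * e)"
      using e m by (simp add: field_simps power2_eq_square)
    then have "ennreal (L z) \<le> ennreal (e / m) * ennreal ((L z)\<^sup>2) + ennreal (m / (4 * e))"
      using e m by (simp flip: ennreal_mult ennreal_plus)
    then show "indicator A z * ennreal (L z)
        \<le> ennreal (e / m) * ennreal ((L z)\<^sup>2) + ennreal (m / (4 * e)) * indicator A z"
      by (auto split: split_indicator)
  qed
  also have "\<dots> = ennreal (e / m) * ennreal m + ennreal (m / (4 * e)) * emeasure gauss_seq A"
    by (subst nn_integral_add) (auto simp: nn_integral_cmult L2)
  also have "ennreal (e / m) * ennreal m = ennreal e"
    using e m by (simp flip: ennreal_mult)
  finally show ?thesis by (simp add: m_def)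
qed

section \<open>The Bayesian model\<close>

lemma measurable_noisy [measurable]:
  "(\<lambda>p. noisy n (fst p) (snd p)) \<in> measurable (seq_space \<Otimes>\<^sub>M seq_space) seq_space"
  by (intro measurable_into_seq_space) (auto simp: noisy_def)

lemma measurable_noisy_fixed [measurable]: "noisy n \<theta> \<in> measurable seq_space seq_space"
  by (intro measurable_into_seq_space) (auto simp: noisy_def)

lemma sets_obs_law [measurable_cong, simp]: "sets (obs_law n \<theta>) = sets seq_space"
  by (simp add: obs_law_def)

lemma nn_integral_obs_law:
  assumes [measurable]: "f \<in> borel_measurable seq_space"
  shows "(\<integral>\<^sup>+x. f x \<partial>obs_law n \<theta>) = (\<integral>\<^sup>+\<xi>. f (noisy n \<theta> \<xi>) \<partial>gauss_seq)"
  unfolding obs_law_def by (subst nn_integral_distr) auto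

lemma measurable_sieve [measurable]:
  "(\<lambda>p. sieve \<tau>0 q (fst p) (snd p)) \<in> measurable (measure_pmf P \<Otimes>\<^sub>M gauss_seq) seq_space"
  by (intro measurable_into_seq_space) (auto simp: sieve_def)

lemma sets_prior [measurable_cong, simp]: "sets (prior lam \<tau>0 q) = sets seq_space"
  by (simp add: prior_def)

lemma prob_space_prior: "prob_space (prior lam \<tau>0 q)"
proof -
  interpret G: prob_space gauss_seq by (rule prob_space_gauss_seq)
  interpret P: pair_prob_space "measure_pmf (poisson_pmf lam)" gauss_seq ..
  show ?thesis unfolding prior_def
    by (intro P.prob_space_distr) (simp add: case_prod_beta)
qed

lemma sets_joint_law [measurable_cong, simp]:
  "sets (joint_law lam \<tau>0 q n) = sets (seq_space \<Otimes>\<^sub>M seq_space)"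
  by (simp add: joint_law_def)

lemma space_joint_law [simp]:
  "space (joint_law lam \<tau>0 q n) = space seq_space \<times> space seq_space"
  by (simp add: joint_law_def space_pair_measure)

lemma prob_space_joint_law: "prob_space (joint_law lam \<tau>0 q n)"
proof -
  interpret G: prob_space gauss_seq by (rule prob_space_gauss_seq)
  interpret R: prob_space "prior lam \<tau>0 q" by (rule prob_space_prior)
  interpret P: pair_prob_space "prior lam \<tau>0 q" gauss_seq ..
  show ?thesis unfolding joint_law_def
    by (intro P.prob_space_distr) (simp add: case_prod_beta)
qed

lemma nn_integral_joint_law:
  assumes [measurable]: "f \<in> borel_measurable (seq_space \<Otimes>\<^sub>M seq_space)"
  shows "(\<integral>\<^sup>+\<omega>. f \<omega> \<partial>joint_law lam \<tau>0 q n)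
    = (\<integral>\<^sup>+k. (\<integral>\<^sup>+z. (\<integral>\<^sup>+\<xi>. f (sieve \<tau>0 q k z, noisy n (sieve \<tau>0 q k z) \<xi>)
        \<partial>gauss_seq) \<partial>gauss_seq) \<partial>poisson_pmf lam)"
proof -
  interpret G: prob_space gauss_seq by (rule prob_space_gauss_seq)
  define g where "g \<theta> = (\<integral>\<^sup>+\<xi>. f (\<theta>, noisy n \<theta> \<xi>) \<partial>gauss_seq)" for \<theta>
  have [measurable]: "(\<lambda>p. f (fst p, noisy n (fst p) (snd p))) \<in> borel_measurable (seq_space \<Otimes>\<^sub>M gauss_seq)"
    by measurable
  have g [measurable]: "g \<in> borel_measurable seq_space"
    unfolding g_def using G.borel_measurable_nn_integral_fst[of "\<lambda>p. f (fst p, noisy n (fst p) (snd p))" seq_space]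
    by simp
  have "(\<integral>\<^sup>+\<omega>. f \<omega> \<partial>joint_law lam \<tau>0 q n)
      = (\<integral>\<^sup>+p. f (fst p, noisy n (fst p) (snd p)) \<partial>(prior lam \<tau>0 q \<Otimes>\<^sub>M gauss_seq))"
    unfolding joint_law_def by (subst nn_integral_distr) (auto simp: case_prod_beta)
  also have "\<dots> = (\<integral>\<^sup>+\<theta>. g \<theta> \<partial>prior lam \<tau>0 q)"
    by (subst G.nn_integral_fst[symmetric]) (auto simp: g_def[abs_def])
  also have "\<dots> = (\<integral>\<^sup>+p. g (sieve \<tau>0 q (fst p) (snd p)) \<partial>(measure_pmf (poisson_pmf lam) \<Otimes>\<^sub>M gauss_seq))"
    unfolding prior_def by (subst nn_integral_distr) (auto simp: case_prod_beta)
  also have "\<dots> = (\<integral>\<^sup>+k. (\<integral>\<^sup>+z. g (sieve \<tau>0 q k z) \<partial>gauss_seq) \<partial>poisson_pmf lam)"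
    by (subst G.nn_integral_fst[symmetric]) auto
  finally show ?thesis by (simp add: g_def)
qed

lemma prior_flip: "distr (prior lam \<tau>0 q) seq_space (flip K) = prior lam \<tau>0 q"
proof -
  let ?P = "measure_pmf (poisson_pmf lam)"
  interpret G: prob_space gauss_seq by (rule prob_space_gauss_seq)
  have G': "sigma_finite_measure (distr gauss_seq seq_space (flip K))"
    unfolding gauss_seq_flip by unfold_locales
  have pair: "distr (?P \<Otimes>\<^sub>M gauss_seq) (?P \<Otimes>\<^sub>M gauss_seq) (\<lambda>(k, z). (k, flip K z)) = ?P \<Otimes>\<^sub>M gauss_seq"
    using pair_measure_distr[of "\<lambda>k. k" ?P ?P "flip K" gauss_seq seq_space, OF _ _ G']
    by (simp add: gauss_seq_flip distr_id2)
       (metis (no_types, lifting) distr_cong sets_gauss_seq sets_pair_measure_cong)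
  have "distr (prior lam \<tau>0 q) seq_space (flip K)
      = distr (?P \<Otimes>\<^sub>M gauss_seq) seq_space (flip K \<circ> (\<lambda>(k, z). sieve \<tau>0 q k z))"
    unfolding prior_def by (intro distr_distr) (auto simp: case_prod_beta)
  also have "flip K \<circ> (\<lambda>(k, z). sieve \<tau>0 q k z) = (\<lambda>(k, z). sieve \<tau>0 q k z) \<circ> (\<lambda>(k, z). (k, flip K z))"
    by (auto simp: fun_eq_iff flip_def sieve_def)
  also have "distr (?P \<Otimes>\<^sub>M gauss_seq) seq_space \<dots>
      = distr (distr (?P \<Otimes>\<^sub>M gauss_seq) (?P \<Otimes>\<^sub>M gauss_seq) (\<lambda>(k, z). (k, flip K z))) seq_space
          (\<lambda>(k, z). sieve \<tau>0 q k z)"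
    by (intro distr_distr[symmetric]) (auto simp: case_prod_beta)
  finally show ?thesis by (simp add: pair prior_def)
qed

lemma noisy_flip: "flip K (noisy n \<theta> \<xi>) = noisy n (flip K \<theta>) (flip K \<xi>)"
  by (auto simp: flip_def noisy_def fun_eq_iff)

definition flip_pair :: "nat \<Rightarrow> (nat \<Rightarrow> real) \<times> (nat \<Rightarrow> real) \<Rightarrow> (nat \<Rightarrow> real) \<times> (nat \<Rightarrow> real)" where
  "flip_pair K \<omega> = (flip K (fst \<omega>), flip K (snd \<omega>))"

lemma measurable_flip_pair [measurable]:
  "flip_pair K \<in> measurable (seq_space \<Otimes>\<^sub>M seq_space) (seq_space \<Otimes>\<^sub>M seq_space)"
  unfolding flip_pair_def by measurable

text \<open>The flip commutes with the observation map, so the separate invariance of the prior and of the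
  noise carries over to the pair.\<close>

lemma joint_law_flip:
  "distr (joint_law lam \<tau>0 q n) (seq_space \<Otimes>\<^sub>M seq_space) (flip_pair K) = joint_law lam \<tau>0 q n"
proof -
  let ?S = "seq_space \<Otimes>\<^sub>M seq_space" and ?R = "prior lam \<tau>0 q"
  interpret G: prob_space gauss_seq by (rule prob_space_gauss_seq)
  have G': "sigma_finite_measure (distr gauss_seq seq_space (flip K))"
    unfolding gauss_seq_flip by unfold_locales
  have pair: "distr (?R \<Otimes>\<^sub>M gauss_seq) ?S (flip_pair K) = ?R \<Otimes>\<^sub>M gauss_seq"
    using pair_measure_distr[of "flip K" ?R seq_space "flip K" gauss_seq seq_space, OF _ _ G']
    by (simp add: gauss_seq_flip prior_flip flip_pair_def case_prod_beta cong: distr_cong)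
  have "distr (joint_law lam \<tau>0 q n) ?S (flip_pair K)
      = distr (?R \<Otimes>\<^sub>M gauss_seq) ?S (flip_pair K \<circ> (\<lambda>(\<theta>, \<xi>). (\<theta>, noisy n \<theta> \<xi>)))"
    unfolding joint_law_def by (intro distr_distr) (auto simp: case_prod_beta)
  also have "flip_pair K \<circ> (\<lambda>(\<theta>, \<xi>). (\<theta>, noisy n \<theta> \<xi>)) = (\<lambda>(\<theta>, \<xi>). (\<theta>, noisy n \<theta> \<xi>)) \<circ> flip_pair K"
    by (auto simp: fun_eq_iff flip_pair_def noisy_flip)
  also have "distr (?R \<Otimes>\<^sub>M gauss_seq) ?S \<dots>
      = distr (distr (?R \<Otimes>\<^sub>M gauss_seq) ?S (flip_pair K)) ?S (\<lambda>(\<theta>, \<xi>). (\<theta>, noisy n \<theta> \<xi>))"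
    by (intro distr_distr[symmetric]) (auto simp: case_prod_beta)
  finally show ?thesis by (simp add: pair joint_law_def)
qed

text \<open>With prior probability \<open>exp (- lam)\<close> one has \<open>k = 0\<close>, and then the data are pure noise.\<close>

lemma obs_law_zero_le_marginal:
  assumes lam: "lam > 0" and [measurable]: "f \<in> borel_measurable seq_space"
  shows "(\<integral>\<^sup>+x. f x \<partial>obs_law n (\<lambda>_. 0))
    \<le> ennreal (exp lam) * (\<integral>\<^sup>+\<omega>. f (snd \<omega>) \<partial>joint_law lam \<tau>0 q n)"
proof -
  interpret G: prob_space gauss_seq by (rule prob_space_gauss_seq)
  define g where "g k = (\<integral>\<^sup>+z. (\<integral>\<^sup>+\<xi>. f (noisy n (sieve \<tau>0 q k z) \<xi>) \<partial>gauss_seq) \<partial>gauss_seq)" for k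
  have "noisy n (sieve \<tau>0 q 0 z) \<xi> = noisy n (\<lambda>_. 0) \<xi>" for z \<xi>
    by (auto simp: noisy_def sieve_def fun_eq_iff)
  then have g0: "g 0 = (\<integral>\<^sup>+x. f x \<partial>obs_law n (\<lambda>_. 0))"
    using G.emeasure_space_1 by (simp add: g_def nn_integral_obs_law)
  have "ennreal (exp (- lam)) * g 0 \<le> (\<integral>\<^sup>+k. ennreal (pmf (poisson_pmf lam) k) * g k \<partial>count_space UNIV)"
    using nn_integral_ge_point[of 0 UNIV "\<lambda>k. ennreal (pmf (poisson_pmf lam) k) * g k"] lam by simp
  also have "\<dots> = (\<integral>\<^sup>+\<omega>. f (snd \<omega>) \<partial>joint_law lam \<tau>0 q n)"
    by (subst nn_integral_joint_law) (auto simp: g_def nn_integral_measure_pmf)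
  finally have "ennreal (exp lam) * (ennreal (exp (- lam)) * g 0)
      \<le> ennreal (exp lam) * (\<integral>\<^sup>+\<omega>. f (snd \<omega>) \<partial>joint_law lam \<tau>0 q n)"
    by (rule mult_left_mono) simp
  also have "ennreal (exp lam) * (ennreal (exp (- lam)) * g 0) = g 0"
    by (simp add: mult.assoc[symmetric] ennreal_mult[symmetric] exp_add[symmetric])
  finally show ?thesis by (simp add: g0)
qed

subsection \<open>Prior coefficients of high index are small\<close>

lemma gauss_seq_abs_moment:
  assumes "1 \<le> j" shows "(\<integral>\<^sup>+z. ennreal \<bar>z j\<bar> \<partial>gauss_seq) \<le> 1"
proof -
  have "(\<integral>\<^sup>+z. ennreal \<bar>z j\<bar> \<partial>gauss_seq)
      = (\<integral>\<^sup>+x. ennreal \<bar>x\<bar> \<partial>distr gauss_seq std_normal_distribution (\<lambda>z. z j))"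
    using assms by (subst nn_integral_distr) auto
  also have "distr gauss_seq std_normal_distribution (\<lambda>z. z j) = std_normal_distribution"
    unfolding gauss_seq_def using assms
    by (intro distr_PiM_component[of "{1..}" "\<lambda>_. std_normal_distribution"] prob_space_std_normal) auto
  also have "(\<integral>\<^sup>+x. ennreal \<bar>x\<bar> \<partial>std_normal_distribution)
      = (\<integral>\<^sup>+x. ennreal (std_normal_density x * \<bar>x\<bar>) \<partial>lborel)"
    by (subst nn_integral_density) (auto simp: ennreal_mult)
  also have "\<dots> = ennreal (sqrt (2 / pi))"
    using std_normal_moment_abs_odd[of 0]
    by (subst nn_integral_eq_integral) (auto simp: has_bochner_integral_iff)
  also have "\<dots> \<le> 1"
    using pi_gt3 by (simp add: field_simps)
  finally show ?thesis .
qed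

lemma poisson_exponential_moment:
  assumes lam: "lam > 0" and r: "r \<ge> 0"
  shows "(\<integral>\<^sup>+k. ennreal (r ^ k) \<partial>poisson_pmf lam) = ennreal (exp (lam * (r - 1)))"
proof -
  have "(\<lambda>k. exp (- lam) * ((lam * r) ^ k /\<^sub>R fact k)) sums (exp (- lam) * exp (lam * r))"
    by (intro sums_mult exp_converges)
  moreover have "exp (- lam) * exp (lam * r) = exp (lam * (r - 1))"
    by (simp add: exp_add[symmetric] algebra_simps)
  ultimately have s: "(\<lambda>k. pmf (poisson_pmf lam) k * r ^ k) sums exp (lam * (r - 1))"
    using lam by (simp add: power_mult_distrib field_simps)
  have "(\<integral>\<^sup>+k. ennreal (r ^ k) \<partial>poisson_pmf lam) = (\<Sum>k. ennreal (pmf (poisson_pmf lam) k * r ^ k))"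
    using r by (simp add: nn_integral_measure_pmf nn_integral_count_space_nat ennreal_mult)
  also have "\<dots> = ennreal (exp (lam * (r - 1)))"
    using s r by (intro suminf_ennreal_eq) auto
  finally show ?thesis .
qed

lemma scale_le:
  assumes "\<tau>0 > 0" "q \<ge> 0" "1 \<le> j" shows "scale \<tau>0 q j \<le> sqrt \<tau>0"
proof -
  have "real j powr (- 2 * q) \<le> real j powr 0"
    using assms by (intro powr_mono) auto
  then show ?thesis using assms unfolding scale_def by (simp add: mult_le_cancel_left1)
qed

text \<open>A coefficient is nonzero only if \<open>k \<ge> j\<close>, an event of probability at most \<open>r\<^bsup>-j\<^esup> E r\<^sup>k\<close>. The
  free base \<open>r\<close> allows the bound to beat any given exponential in \<open>j\<close>.\<close>

lemma joint_law_abs_parameter: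
  assumes lam: "lam > 0" and \<tau>0: "\<tau>0 > 0" and q: "q \<ge> 0" and r: "r \<ge> 1" and j: "1 \<le> j"
  shows "(\<integral>\<^sup>+\<omega>. ennreal \<bar>fst \<omega> j\<bar> \<partial>joint_law lam \<tau>0 q n)
    \<le> ennreal (sqrt \<tau>0 * exp (lam * (r - 1)) * (1 / r) ^ j)"
proof -
  interpret G: prob_space gauss_seq by (rule prob_space_gauss_seq)
  note [measurable] = measurable_seq_component[OF j]
  have inner: "(\<integral>\<^sup>+z. (\<integral>\<^sup>+\<xi>. ennreal \<bar>sieve \<tau>0 q k z j\<bar> \<partial>gauss_seq) \<partial>gauss_seq)
      \<le> ennreal (sqrt \<tau>0 * (1 / r) ^ j) * ennreal (r ^ k)" for k
  proof (cases "j \<le> k")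
    case True
    have "(\<integral>\<^sup>+z. (\<integral>\<^sup>+\<xi>. ennreal \<bar>sieve \<tau>0 q k z j\<bar> \<partial>gauss_seq) \<partial>gauss_seq)
        = (\<integral>\<^sup>+z. ennreal (scale \<tau>0 q j) * ennreal \<bar>z j\<bar> \<partial>gauss_seq)"
      using G.emeasure_space_1 True j \<tau>0
      by (simp add: sieve_def abs_mult ennreal_mult scale_def)
    also have "\<dots> = ennreal (scale \<tau>0 q j) * (\<integral>\<^sup>+z. ennreal \<bar>z j\<bar> \<partial>gauss_seq)"
      by (rule nn_integral_cmult) measurable
    also have "\<dots> \<le> ennreal (sqrt \<tau>0) * 1"
      by (intro mult_mono gauss_seq_abs_moment[OF j] ennreal_leI scale_le[OF \<tau>0 q j]) auto
    also have "\<dots> \<le> ennreal (sqrt \<tau>0 * (1 / r) ^ j * r ^ k)"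
    proof -
      have "1 \<le> (1 / r) ^ j * r ^ k"
        using power_increasing[OF True r] r by (simp add: power_divide field_simps)
      from mult_left_mono[OF this, of "sqrt \<tau>0"] show ?thesis
        using \<tau>0 by (simp add: mult.assoc ennreal_leI)
    qed
    finally show ?thesis using \<tau>0 r by (simp add: ennreal_mult)
  next
    case False
    then show ?thesis using j by (simp add: sieve_def)
  qed
  have "(\<integral>\<^sup>+\<omega>. ennreal \<bar>fst \<omega> j\<bar> \<partial>joint_law lam \<tau>0 q n)
      = (\<integral>\<^sup>+k. (\<integral>\<^sup>+z. (\<integral>\<^sup>+\<xi>. ennreal \<bar>sieve \<tau>0 q k z j\<bar> \<partial>gauss_seq) \<partial>gauss_seq) \<partial>poisson_pmf lam)"
    by (subst nn_integral_joint_law) auto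
  also have "\<dots> \<le> (\<integral>\<^sup>+k. ennreal (sqrt \<tau>0 * (1 / r) ^ j) * ennreal (r ^ k) \<partial>poisson_pmf lam)"
    by (intro nn_integral_mono inner)
  also have "\<dots> = ennreal (sqrt \<tau>0 * (1 / r) ^ j) * ennreal (exp (lam * (r - 1)))"
    using poisson_exponential_moment[OF lam, of r] r by (subst nn_integral_cmult) auto
  finally show ?thesis using \<tau>0 r by (simp add: ennreal_mult[symmetric] mult_ac)
qed

section \<open>Properties of the posterior mean\<close>

lemma posterior_mean_measurable:
  "posterior_mean lam \<tau>0 q n h \<Longrightarrow> 1 \<le> j \<Longrightarrow> (\<lambda>x. h x j) \<in> borel_measurable seq_space"
  by (simp add: posterior_mean_def)

lemma finite_measure_subalgebra_observation:
  "finite_measure_subalgebra (joint_law lam \<tau>0 q n)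
     (vimage_algebra (space (joint_law lam \<tau>0 q n)) snd seq_space)"
proof -
  interpret J: prob_space "joint_law lam \<tau>0 q n" by (rule prob_space_joint_law)
  have "snd \<in> measurable (joint_law lam \<tau>0 q n) seq_space" by measurable
  from measurable_sets[OF this] have "subalgebra (joint_law lam \<tau>0 q n)
      (vimage_algebra (space (joint_law lam \<tau>0 q n)) snd seq_space)"
    unfolding subalgebra_def
    by (subst sets_vimage_algebra2) auto
  then show ?thesis by unfold_locales
qed

lemma posterior_mean_abs_le:
  assumes h: "posterior_mean lam \<tau>0 q n h" and j: "1 \<le> j"
  shows "(\<integral>\<^sup>+\<omega>. ennreal \<bar>h (snd \<omega>) j\<bar> \<partial>joint_law lam \<tau>0 q n)
    \<le> (\<integral>\<^sup>+\<omega>. ennreal \<bar>fst \<omega> j\<bar> \<partial>joint_law lam \<tau>0 q n)"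
proof -
  define J where "J = joint_law lam \<tau>0 q n"
  define F where "F = vimage_algebra (space J) snd seq_space"
  interpret finite_measure_subalgebra J F
    unfolding J_def F_def by (rule finite_measure_subalgebra_observation)
  note [measurable] = measurable_seq_component[OF j]
  have [measurable_cong]: "sets J = sets (seq_space \<Otimes>\<^sub>M seq_space)" by (simp add: J_def)
  have [measurable]: "(\<lambda>\<omega>. fst \<omega> j) \<in> borel_measurable J" by measurable
  have "AE \<omega> in J. h (snd \<omega>) j = real_cond_exp J F (\<lambda>\<omega>. fst \<omega> j) \<omega>"
    using h j unfolding posterior_mean_def J_def F_def Let_def by blast
  with real_cond_exp_abs[of "\<lambda>\<omega>. fst \<omega> j"]
  have "AE \<omega> in J. ennreal \<bar>h (snd \<omega>) j\<bar> \<le> nn_cond_exp J F (\<lambda>\<omega>. ennreal \<bar>fst \<omega> j\<bar>) \<omega>"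
    by (auto elim!: AE_mp)
  then have "(\<integral>\<^sup>+\<omega>. ennreal \<bar>h (snd \<omega>) j\<bar> \<partial>J) \<le> (\<integral>\<^sup>+\<omega>. 1 * nn_cond_exp J F (\<lambda>\<omega>. ennreal \<bar>fst \<omega> j\<bar>) \<omega> \<partial>J)"
    by (intro nn_integral_mono_AE) auto
  also have "\<dots> = (\<integral>\<^sup>+\<omega>. 1 * ennreal \<bar>fst \<omega> j\<bar> \<partial>J)"
    by (rule nn_cond_exp_intg) auto
  finally show ?thesis by (simp add: J_def)
qed

text \<open>For \<open>j \<le> K\<close> the flip does not act on the \<open>j\<close>-th coefficient. By invariance of the joint law, the
  posterior mean evaluated at the flipped observation has the integrals that characterize the
  conditional expectation, so it agrees with the original one almost everywhere.\<close>

lemma posterior_mean_flip: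
  assumes lam: "lam > 0" and \<tau>0: "\<tau>0 > 0" and q: "q \<ge> 0"
    and h: "posterior_mean lam \<tau>0 q n h" and j: "1 \<le> j" "j \<le> K"
  shows "AE \<omega> in joint_law lam \<tau>0 q n. h (flip K (snd \<omega>)) j = h (snd \<omega>) j"
proof -
  define J where "J = joint_law lam \<tau>0 q n"
  define F where "F = vimage_algebra (space J) snd seq_space"
  interpret finite_measure_subalgebra J F
    unfolding J_def F_def by (rule finite_measure_subalgebra_observation)
  note [measurable] = measurable_seq_component[OF j(1)] posterior_mean_measurable[OF h j(1)]
  have [measurable_cong]: "sets J = sets (seq_space \<Otimes>\<^sub>M seq_space)" by (simp add: J_def)
  have sp: "space J = space seq_space \<times> space seq_space" by (simp add: J_def)
  have flip_J: "distr J (seq_space \<Otimes>\<^sub>M seq_space) (flip_pair K) = J"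
    by (simp add: J_def joint_law_flip)
  have snd_F [measurable]: "snd \<in> measurable F seq_space"
    unfolding F_def by (rule measurable_vimage_algebra1) (auto simp: sp)
  have AE_h: "AE \<omega> in J. h (snd \<omega>) j = real_cond_exp J F (\<lambda>\<omega>. fst \<omega> j) \<omega>"
    using h j unfolding posterior_mean_def J_def F_def Let_def by blast
  have int_fst: "integrable J (\<lambda>\<omega>. fst \<omega> j)"
  proof (rule integrableI_bounded)
    show "(\<integral>\<^sup>+\<omega>. ennreal (norm (fst \<omega> j)) \<partial>J) < \<infinity>"
      using joint_law_abs_parameter[OF lam \<tau>0 q order.refl j(1), of n]
      by (simp add: J_def le_less_trans)
  qed measurable
  have int_h: "integrable J (\<lambda>\<omega>. h (snd \<omega>) j)"
  proof (rule integrableI_bounded)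
    have "(\<integral>\<^sup>+\<omega>. ennreal (norm (h (snd \<omega>) j)) \<partial>J) \<le> (\<integral>\<^sup>+\<omega>. ennreal (norm (fst \<omega> j)) \<partial>J)"
      using posterior_mean_abs_le[OF h j(1)] by (simp add: J_def)
    also have "\<dots> < \<infinity>" using int_fst by (simp add: integrable_iff_bounded)
    finally show "(\<integral>\<^sup>+\<omega>. ennreal (norm (h (snd \<omega>) j)) \<partial>J) < \<infinity>" .
  qed measurable
  have inv: "(\<integral>\<omega>. g (flip_pair K \<omega>) \<partial>J) = (\<integral>\<omega>. g \<omega> \<partial>J)"
    if [measurable]: "g \<in> borel_measurable (seq_space \<Otimes>\<^sub>M seq_space)" for g :: "_ \<Rightarrow> real"
    by (subst (2) flip_J[symmetric], subst integral_distr) auto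
  have int_hflip: "integrable J (\<lambda>\<omega>. h (flip K (snd \<omega>)) j)"
  proof -
    have "integrable (distr J (seq_space \<Otimes>\<^sub>M seq_space) (flip_pair K)) (\<lambda>\<omega>. h (snd \<omega>) j)"
      using int_h by (simp add: flip_J)
    then show ?thesis
      by (subst (asm) integrable_distr_eq) (auto simp: flip_pair_def)
  qed
  have "AE \<omega> in J. real_cond_exp J F (\<lambda>\<omega>. fst \<omega> j) \<omega> = h (flip K (snd \<omega>)) j"
  proof (rule real_cond_exp_charact[OF _ int_fst int_hflip])
    fix A assume "A \<in> sets F"
    then obtain B where B [measurable]: "B \<in> sets seq_space" and A: "A = snd -` B \<inter> space J"
      unfolding F_def by (subst (asm) sets_vimage_algebra2) (auto simp: sp)
    define B' where "B' = flip K -` B \<inter> space seq_space"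
    have [measurable]: "B' \<in> sets seq_space" unfolding B'_def by measurable
    have "(\<integral>\<omega>\<in>A. fst \<omega> j \<partial>J) = (\<integral>\<omega>. indicator B (snd \<omega>) * fst \<omega> j \<partial>J)"
      unfolding set_lebesgue_integral_def A by (intro Bochner_Integration.integral_cong) (auto simp: indicator_def)
    also have "\<dots> = (\<integral>\<omega>. indicator B (snd (flip_pair K \<omega>)) * fst (flip_pair K \<omega>) j \<partial>J)"
      by (rule inv[symmetric]) measurable
    also have "\<dots> = (\<integral>\<omega>. indicator B' (snd \<omega>) * fst \<omega> j \<partial>J)"
      using j by (intro Bochner_Integration.integral_cong)
        (auto simp: sp B'_def flip_pair_def indicator_def flip_apply)
    also have "\<dots> = (\<integral>\<omega>\<in>(snd -` B' \<inter> space J). fst \<omega> j \<partial>J)"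
      unfolding set_lebesgue_integral_def by (intro Bochner_Integration.integral_cong) (auto simp: indicator_def)
    also have "\<dots> = (\<integral>\<omega>\<in>(snd -` B' \<inter> space J). real_cond_exp J F (\<lambda>\<omega>. fst \<omega> j) \<omega> \<partial>J)"
      by (intro real_cond_exp_intA int_fst) (auto simp: F_def intro!: in_vimage_algebra)
    also have "\<dots> = (\<integral>\<omega>\<in>(snd -` B' \<inter> space J). h (snd \<omega>) j \<partial>J)"
      unfolding set_lebesgue_integral_def
    proof (rule integral_cong_AE)
      show "AE \<omega> in J. indicat_real (snd -` B' \<inter> space J) \<omega> *\<^sub>R real_cond_exp J F (\<lambda>\<omega>. fst \<omega> j) \<omega> =
          indicat_real (snd -` B' \<inter> space J) \<omega> *\<^sub>R h (snd \<omega>) j"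
        using AE_h by (auto elim!: AE_mp)
    qed measurable
    also have "\<dots> = (\<integral>\<omega>. indicator B' (snd \<omega>) * h (snd \<omega>) j \<partial>J)"
      unfolding set_lebesgue_integral_def by (intro Bochner_Integration.integral_cong) (auto simp: indicator_def)
    also have "\<dots> = (\<integral>\<omega>. indicator B' (snd (flip_pair K \<omega>)) * h (snd (flip_pair K \<omega>)) j \<partial>J)"
      by (rule inv[symmetric]) measurable
    also have "\<dots> = (\<integral>\<omega>\<in>A. h (flip K (snd \<omega>)) j \<partial>J)"
      unfolding set_lebesgue_integral_def A
      using measurable_space[OF measurable_flip]
      by (intro Bochner_Integration.integral_cong)
        (auto simp: sp B'_def flip_pair_def indicator_def flip_flip)
    finally show "(\<integral>\<omega>\<in>A. fst \<omega> j \<partial>J) = (\<integral>\<omega>\<in>A. h (flip K (snd \<omega>)) j \<partial>J)" .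
  qed measurable
  with AE_h show ?thesis unfolding J_def[symmetric] by (auto elim!: AE_mp)
qed

text \<open>The total size of the estimated coefficients beyond \<open>K\<close>, with values in the extended reals so
  that summability need not be known beforehand; where it is finite, the expansion converges.\<close>

definition tail :: "((nat \<Rightarrow> real) \<Rightarrow> (nat \<Rightarrow> real)) \<Rightarrow> nat \<Rightarrow> (nat \<Rightarrow> real) \<Rightarrow> ennreal" where
  "tail h K x = (\<Sum>j. ennreal \<bar>h x (Suc (K + j))\<bar>)"

lemma measurable_tail:
  assumes "posterior_mean lam \<tau>0 q n h" shows "tail h K \<in> borel_measurable seq_space"
proof -
  have [measurable]: "(\<lambda>x. h x (Suc i)) \<in> borel_measurable seq_space" for i
    by (rule posterior_mean_measurable[OF assms]) simp
  show ?thesis unfolding tail_def by measurable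
qed

text \<open>The base \<open>r = exp 2\<close> is chosen so that the bound, multiplied by the factor \<open>exp K\<close> that the
  change to the two alternatives costs, still tends to \<open>0\<close> exponentially.\<close>

lemma nn_integral_tail_le:
  assumes lam: "lam > 0" and \<tau>0: "\<tau>0 > 0" and q: "q \<ge> 0" and h: "posterior_mean lam \<tau>0 q n h"
  shows "(\<integral>\<^sup>+x. tail h K x \<partial>obs_law n (\<lambda>_. 0)) \<le> ennreal (sqrt \<tau>0 * exp (lam * exp 2) * exp (- 2 * real K))"
proof -
  let ?J = "joint_law lam \<tau>0 q n"
  define r :: real where "r = exp 2"
  define C where "C = sqrt \<tau>0 * exp (lam * (r - 1))"
  have r: "r \<ge> 2" using exp_ge_add_one_self[of 2] by (simp add: r_def)
  have C: "C \<ge> 0" using \<tau>0 by (simp add: C_def)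
  have [measurable]: "(\<lambda>x. h x (Suc i)) \<in> borel_measurable seq_space" for i
    by (rule posterior_mean_measurable[OF h]) simp
  have "(\<lambda>j. (1 / r) ^ j) sums (1 / (1 - 1 / r))"
    using r by (intro geometric_sums) auto
  from sums_mult[OF this, of "C * (1 / r) ^ Suc K"]
  have sums: "(\<lambda>j. C * (1 / r) ^ Suc (K + j)) sums (C * (1 / r) ^ Suc K * (1 / (1 - 1 / r)))"
    by (simp add: power_add mult_ac)
  have "(\<integral>\<^sup>+\<omega>. tail h K (snd \<omega>) \<partial>?J) = (\<Sum>j. \<integral>\<^sup>+\<omega>. ennreal \<bar>h (snd \<omega>) (Suc (K + j))\<bar> \<partial>?J)"
    unfolding tail_def by (rule nn_integral_suminf) measurable
  also have "\<dots> \<le> (\<Sum>j. ennreal (C * (1 / r) ^ Suc (K + j)))"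
    unfolding C_def using r
    by (intro suminf_le summableI order.trans[OF posterior_mean_abs_le[OF h]]
          joint_law_abs_parameter[OF lam \<tau>0 q]) auto
  also have "\<dots> = ennreal (C * (1 / r) ^ Suc K * (1 / (1 - 1 / r)))"
    using sums C r by (intro suminf_ennreal_eq) auto
  also have "\<dots> \<le> ennreal (C * (1 / r) ^ K)"
  proof (rule ennreal_leI)
    have "(1 / r) * (1 / (1 - 1 / r)) \<le> 1" using r by (simp add: field_simps)
    from mult_left_mono[OF this, of "C * (1 / r) ^ K"]
    show "C * (1 / r) ^ Suc K * (1 / (1 - 1 / r)) \<le> C * (1 / r) ^ K"
      using C r by (simp add: mult_ac)
  qed
  finally have J: "(\<integral>\<^sup>+\<omega>. tail h K (snd \<omega>) \<partial>?J) \<le> ennreal (C * (1 / r) ^ K)" .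
  have "(\<integral>\<^sup>+x. tail h K x \<partial>obs_law n (\<lambda>_. 0)) \<le> ennreal (exp lam) * (\<integral>\<^sup>+\<omega>. tail h K (snd \<omega>) \<partial>?J)"
    by (rule obs_law_zero_le_marginal[OF lam measurable_tail[OF h]])
  also have "\<dots> \<le> ennreal (exp lam) * ennreal (C * (1 / r) ^ K)"
    by (intro mult_left_mono J) auto
  also have "\<dots> = ennreal (sqrt \<tau>0 * exp (lam * exp 2) * exp (- 2 * real K))"
  proof -
    have "(1 / r) ^ K = exp (- 2 * real K)"
      by (simp add: r_def power_divide exp_of_nat_mult[symmetric] exp_minus field_simps)
    moreover have "exp lam * C = sqrt \<tau>0 * exp (lam * exp 2)"
      by (simp add: C_def r_def exp_add[symmetric] algebra_simps)
    ultimately have "exp lam * (C * (1 / r) ^ K) = sqrt \<tau>0 * exp (lam * exp 2) * exp (- 2 * real K)"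
      by (simp add: mult.assoc[symmetric])
    then show ?thesis using C r by (simp add: ennreal_mult[symmetric])
  qed
  finally show ?thesis .
qed

section \<open>The two alternatives\<close>

definition block :: "nat \<Rightarrow> nat \<Rightarrow> real \<Rightarrow> nat \<Rightarrow> real" where
  "block n K b = (\<lambda>j. if j \<in> {K<..2 * K} then b / sqrt (real n) else 0)"

lemma noisy_block: "noisy n (block n K b) \<xi> = noisy n (\<lambda>_. 0) (translate {K<..2 * K} b \<xi>)"
  by (auto simp: noisy_def block_def translate_def fun_eq_iff add_divide_distrib)

lemma obs_law_block_event:
  assumes [measurable]: "A \<in> sets seq_space" and e: "e > 0"
  shows "emeasure (obs_law n (block n K b)) A
    \<le> ennreal e + ennreal (exp (b\<^sup>2 * K) / (4 * e)) * emeasure (obs_law n (\<lambda>_. 0)) A"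
proof -
  define A' where "A' = noisy n (\<lambda>_. 0) -` A \<inter> space seq_space"
  have A' [measurable]: "A' \<in> sets seq_space" unfolding A'_def by measurable
  have I: "finite {K<..2 * K}" "{K<..2 * K} \<subseteq> {1..}" by auto
  have "emeasure (obs_law n (block n K b)) A
      = (\<integral>\<^sup>+\<xi>. indicator A (noisy n (block n K b) \<xi>) \<partial>gauss_seq)"
    by (subst nn_integral_obs_law[symmetric]) auto
  also have "\<dots> = (\<integral>\<^sup>+\<xi>. indicator A' (translate {K<..2 * K} b \<xi>) \<partial>gauss_seq)"
    using measurable_space[OF measurable_translate[OF I(2)]]
    by (intro nn_integral_cong) (auto simp: noisy_block A'_def split: split_indicator)
  also have "\<dots> \<le> ennreal e + ennreal (exp (b\<^sup>2 * card {K<..2 * K}) / (4 * e)) * emeasure gauss_seq A'"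
    by (rule gauss_seq_translate_event[OF I A' e])
  also have "emeasure gauss_seq A' = emeasure (obs_law n (\<lambda>_. 0)) A"
    unfolding A'_def obs_law_def by (subst emeasure_distr) auto
  finally show ?thesis by simp
qed

text \<open>The bound on events holds with arbitrarily small \<open>e\<close>, so null sets under the zero parameter are
  null sets under the alternatives.\<close>

lemma obs_law_block_AE:
  assumes ae: "AE x in obs_law n (\<lambda>_. 0). P x" and m: "{x \<in> space seq_space. \<not> P x} \<in> sets seq_space"
  shows "AE x in obs_law n (block n K b). P x"
proof -
  let ?A = "{x \<in> space seq_space. \<not> P x}"
  have sp: "space (obs_law n \<theta>) = space seq_space" for \<theta> by (simp add: obs_law_def)
  have 0: "emeasure (obs_law n (\<lambda>_. 0)) ?A = 0"
    using ae m by (subst (asm) AE_iff_measurable[of ?A]) (auto simp: sp)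
  have "emeasure (obs_law n (block n K b)) ?A \<le> 0"
    by (rule ennreal_le_epsilon) (use obs_law_block_event[OF m, where n = n and K = K and b = b] 0 in simp)
  then show ?thesis
    using m by (subst AE_iff_measurable[of ?A]) (auto simp: sp)
qed

lemma nn_integral_obs_law_block_flip:
  assumes [measurable]: "f \<in> borel_measurable seq_space"
  shows "(\<integral>\<^sup>+x. f x \<partial>obs_law n (block n K (- b))) = (\<integral>\<^sup>+x. f (flip K x) \<partial>obs_law n (block n K b))"
proof -
  have eq: "noisy n (flip K (block n K b)) \<xi> = noisy n (block n K (- b)) \<xi>" for \<xi>
    by (auto simp: noisy_def flip_def block_def fun_eq_iff)
  have "(\<integral>\<^sup>+x. f (flip K x) \<partial>obs_law n (block n K b))
      = (\<integral>\<^sup>+\<xi>. f (noisy n (block n K (- b)) (flip K \<xi>)) \<partial>gauss_seq)"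
    by (subst nn_integral_obs_law) (auto simp: noisy_flip eq)
  also have "\<dots> = (\<integral>\<^sup>+\<xi>. f (noisy n (block n K (- b)) \<xi>) \<partial>distr gauss_seq seq_space (flip K))"
    by (subst nn_integral_distr) auto
  finally show ?thesis by (simp add: gauss_seq_flip nn_integral_obs_law)
qed

lemma posterior_mean_flip_block:
  assumes lam: "lam > 0" and \<tau>0: "\<tau>0 > 0" and q: "q \<ge> 0"
    and h: "posterior_mean lam \<tau>0 q n h" and j: "1 \<le> j" "j \<le> K"
  shows "AE x in obs_law n (block n K b). h (flip K x) j = h x j"
proof (rule obs_law_block_AE)
  let ?N = "{x \<in> space seq_space. h (flip K x) j \<noteq> h x j}"
  note hm = posterior_mean_measurable[OF h j(1)]
  show N [measurable]: "?N \<in> sets seq_space"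
    by (intro borel_measurable_neq hm measurable_compose[OF measurable_flip hm])
  have "(\<integral>\<^sup>+x. indicator ?N x \<partial>obs_law n (\<lambda>_. 0))
      \<le> ennreal (exp lam) * (\<integral>\<^sup>+\<omega>. indicator ?N (snd \<omega>) \<partial>joint_law lam \<tau>0 q n)"
    by (rule obs_law_zero_le_marginal[OF lam]) measurable
  also have "(\<integral>\<^sup>+\<omega>. indicator ?N (snd \<omega>) \<partial>joint_law lam \<tau>0 q n) = (\<integral>\<^sup>+\<omega>. 0 \<partial>joint_law lam \<tau>0 q n)"
    by (rule nn_integral_cong_AE, rule AE_mp[OF posterior_mean_flip[OF lam \<tau>0 q h j]]) simp
  finally have "emeasure (obs_law n (\<lambda>_. 0)) ?N = 0" by simp
  then show "AE x in obs_law n (\<lambda>_. 0). h (flip K x) j = h x j"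
    using N by (subst AE_iff_measurable[of ?N]) (auto simp: obs_law_def)
qed

lemma expansion_split:
  assumes \<psi>: "\<And>j. j \<ge> 1 \<Longrightarrow> \<psi> j t = 1"
    and a: "(\<Sum>j. ennreal \<bar>a (Suc (K + j))\<bar>) \<le> ennreal d" and d: "d \<ge> 0"
  shows "\<bar>expansion \<psi> a t - (\<Sum>j<K. a (Suc j))\<bar> \<le> d"
proof -
  have s: "summable (\<lambda>j. \<bar>a (Suc (j + K))\<bar>)"
    using a by (intro summable_suminf_not_top) (auto simp: add.commute top_unique)
  then have s': "summable (\<lambda>j. a (Suc (j + K)))" by (rule summable_rabs_cancel)
  then have "summable (\<lambda>j. a (Suc j))" by (subst (asm) summable_iff_shift)
  then have "(\<Sum>j. a (Suc j)) = (\<Sum>j. a (Suc (j + K))) + (\<Sum>j<K. a (Suc j))"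
    by (rule suminf_split_initial_segment)
  moreover have "expansion \<psi> a t = (\<Sum>j. a (Suc j))"
    by (simp add: expansion_def \<psi>)
  moreover have "\<bar>\<Sum>j. a (Suc (j + K))\<bar> \<le> (\<Sum>j. \<bar>a (Suc (j + K))\<bar>)"
    by (rule summable_rabs) (rule s)
  moreover have "(\<Sum>j. \<bar>a (Suc (j + K))\<bar>) \<le> d"
    using a d s by (subst (asm) suminf_ennreal2) (auto simp: add.commute)
  ultimately show ?thesis by linarith
qed

lemma expansion_block:
  assumes "\<And>j. j \<ge> 1 \<Longrightarrow> \<psi> j t = 1"
  shows "expansion \<psi> (block n K b) t = b * real K / sqrt (real n)"
proof -
  have "expansion \<psi> (block n K b) t = (\<Sum>j\<in>{K..<2 * K}. block n K b (Suc j))"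
    unfolding expansion_def using assms by (subst suminf_finite[of "{K..<2 * K}"]) (auto simp: block_def)
  also have "\<dots> = (\<Sum>j\<in>{K..<2 * K}. b / sqrt (real n))"
    by (intro sum.cong) (auto simp: block_def)
  finally show ?thesis by simp
qed

lemma block_in_sobolev:
  assumes b: "b\<^sup>2 \<le> 1" and \<beta>: "\<beta> \<ge> 0" and n: "n \<ge> 1" and K: "real K * (2 * real K) powr (2 * \<beta>) < L * real n"
  shows "block n K b \<in> sobolev \<beta> L"
proof -
  let ?f = "\<lambda>j. (block n K b (Suc j))\<^sup>2 * real (Suc j) powr (2 * \<beta>)"
  have 0: "?f j = 0" if "j \<notin> {K..<2 * K}" for j using that by (auto simp: block_def)
  have "(\<Sum>j\<in>{K..<2 * K}. ?f j) \<le> (\<Sum>j\<in>{K..<2 * K}. 1 / real n * (2 * real K) powr (2 * \<beta>))"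
  proof (intro sum_mono mult_mono)
    fix j assume "j \<in> {K..<2 * K}"
    then show "(block n K b (Suc j))\<^sup>2 \<le> 1 / real n"
      using b by (simp add: block_def power_divide divide_right_mono)
    show "real (Suc j) powr (2 * \<beta>) \<le> (2 * real K) powr (2 * \<beta>)"
      using \<open>j \<in> _\<close> \<beta> by (intro powr_mono2) auto
  qed auto
  also have "\<dots> = real K * (2 * real K) powr (2 * \<beta>) / real n" by simp
  also have "\<dots> < L" using K n by (simp add: field_simps)
  finally have "(\<Sum>j\<in>{K..<2 * K}. ?f j) < L" .
  moreover have "(\<Sum>j. ?f j) = (\<Sum>j\<in>{K..<2 * K}. ?f j)"
    by (rule suminf_finite) (use 0 in auto)
  moreover have "summable ?f"
    by (rule summable_finite[of "{K..<2 * K}"]) (use 0 in auto)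
  ultimately show ?thesis unfolding sobolev_def by simp
qed

text \<open>Both risks are written as integrals under the law of the data for the parameter with positive
  sign, the second one with the flipped observation. Off an event of small probability the
  estimator changes by at most \<open>F\<close> under the flip, whereas the two targets \<open>F\<close> and \<open>- F\<close> are \<open>2F\<close>
  apart, so the two errors differ by at least \<open>F\<close> and their squares add up to at least
  \<open>F\<^sup>2 / 2\<close>. The assumption \<open>small\<close> makes the exceptional event improbable.\<close>

lemma local_risk_two_point:
  assumes lam: "lam > 0" and \<tau>0: "\<tau>0 > 0" and q: "q \<ge> 0" and h: "posterior_mean lam \<tau>0 q n h"
    and n: "n \<ge> 1" and K: "K \<ge> 1" and \<psi>: "\<And>j. j \<ge> 1 \<Longrightarrow> \<psi> j t = 1"
    and small: "32 * (sqrt \<tau>0 * exp (lam * exp 2)) * sqrt (real n) \<le> exp (real K)"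
  shows "ennreal ((real K)\<^sup>2 / (4 * real n))
    \<le> local_risk \<psi> n h (block n K 1) t + local_risk \<psi> n h (block n K (- 1)) t"
proof -
  define F where "F = real K / sqrt (real n)"
  have F: "F > 0" using n K by (simp add: F_def)
  note [measurable] = measurable_tail[OF h, of K]
  have hm [measurable]: "(\<lambda>x. h x j) \<in> borel_measurable seq_space" if "1 \<le> j" for j
    by (rule posterior_mean_measurable[OF h that])
  define A where "A = {x \<in> space seq_space. 1 \<le> ennreal (2 / F) * tail h K x}"
  have A [measurable]: "A \<in> sets seq_space" unfolding A_def by measurable
  let ?D = "sqrt \<tau>0 * exp (lam * exp 2)"
  have sp: "space (obs_law n \<theta>) = space seq_space" for \<theta> by (simp add: obs_law_def)
  have A0: "emeasure (obs_law n (\<lambda>_. 0)) A \<le> ennreal (2 / F * (?D * exp (- 2 * real K)))"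
  proof -
    have "emeasure (obs_law n (\<lambda>_. 0)) A
        \<le> ennreal (2 / F) * (\<integral>\<^sup>+x. tail h K x * indicator (space seq_space) x \<partial>obs_law n (\<lambda>_. 0))"
      unfolding A_def by (rule nn_integral_Markov_inequality) auto
    also have "(\<integral>\<^sup>+x. tail h K x * indicator (space seq_space) x \<partial>obs_law n (\<lambda>_. 0))
        = (\<integral>\<^sup>+x. tail h K x \<partial>obs_law n (\<lambda>_. 0))"
      by (intro nn_integral_cong) (simp add: sp)
    also have "ennreal (2 / F) * \<dots> \<le> ennreal (2 / F) * ennreal (?D * exp (- 2 * real K))"
      by (intro mult_left_mono nn_integral_tail_le[OF lam \<tau>0 q h]) simp
    finally show ?thesis using F \<tau>0 by (simp add: ennreal_mult[symmetric])
  qed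
  \<comment> \<open>the error budget \<open>1/4\<close> is split evenly between the free term \<open>e\<close> and the likelihood-ratio term\<close>
  have A1: "emeasure (obs_law n (block n K b)) A \<le> ennreal (1 / 4)" if b: "b\<^sup>2 = 1" for b
  proof -
    have "emeasure (obs_law n (block n K b)) A
        \<le> ennreal (1 / 8) + ennreal (exp (b\<^sup>2 * K) / (4 * (1 / 8))) * emeasure (obs_law n (\<lambda>_. 0)) A"
      by (rule obs_law_block_event[OF A]) simp
    also have "\<dots> \<le> ennreal (1 / 8) + ennreal (2 * exp (real K)) * ennreal (2 / F * (?D * exp (- 2 * real K)))"
      using b by (intro add_left_mono mult_mono A0) auto
    also have "\<dots> = ennreal (1 / 8 + 4 * ?D * (exp (real K) * exp (- 2 * real K)) / F)"
      using F \<tau>0 by (simp add: ennreal_mult[symmetric] ennreal_plus[symmetric] field_simps del: ennreal_plus)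
    also have "\<dots> \<le> ennreal (1 / 4)"
    proof (rule ennreal_leI)
      have decay: "exp (real K) * exp (- 2 * real K) = 1 / exp (real K)"
        by (simp add: exp_add[symmetric] exp_minus[symmetric] inverse_eq_divide[symmetric])
      have "32 * ?D \<le> F * exp (real K)"
      proof -
        have "1 * exp (real K) \<le> real K * exp (real K)"
          using K by (intro mult_right_mono) auto
        then have "32 * ?D * sqrt (real n) \<le> real K * exp (real K)"
          using small by linarith
        then show ?thesis using n by (simp add: F_def field_simps)
      qed
      then show "1 / 8 + 4 * ?D * (exp (real K) * exp (- 2 * real K)) / F \<le> 1 / 4"
        unfolding decay using F by (simp add: field_simps)
    qed
    finally show ?thesis .
  qed
  define P where "P = obs_law n (block n K 1)"
  have P_sets [measurable_cong]: "sets P = sets seq_space" by (simp add: P_def)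
  interpret G: prob_space gauss_seq by (rule prob_space_gauss_seq)
  interpret P: prob_space P unfolding P_def obs_law_def by (rule G.prob_space_distr) simp
  let ?E = "\<lambda>x. expansion \<psi> (h x) t"
  have Em [measurable]: "?E \<in> borel_measurable seq_space"
    unfolding expansion_def by measurable
  let ?p = "\<lambda>x. ennreal ((?E x - F)\<^sup>2)" and ?m = "\<lambda>x. ennreal ((?E x + F)\<^sup>2)"
  have risk_plus: "local_risk \<psi> n h (block n K 1) t = (\<integral>\<^sup>+x. ?p x \<partial>P)"
    using \<psi> by (simp add: local_risk_def expansion_block P_def F_def)
  have risk_minus: "local_risk \<psi> n h (block n K (- 1)) t = (\<integral>\<^sup>+x. ?m (flip K x) \<partial>P)"
    using \<psi> unfolding local_risk_def P_def
    by (subst nn_integral_obs_law_block_flip) (auto simp: expansion_block F_def)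
  have flip_A: "(\<integral>\<^sup>+x. indicator A (flip K x) \<partial>P) = emeasure (obs_law n (block n K (- 1))) A"
    unfolding P_def by (subst nn_integral_obs_law_block_flip[symmetric]) auto
  have sym: "AE x in P. \<forall>j\<in>{1..K}. h (flip K x) j = h x j"
    unfolding P_def using posterior_mean_flip_block[OF lam \<tau>0 q h] by (intro AE_finite_allI) auto
  have "ennreal (F\<^sup>2 / 2) = (\<integral>\<^sup>+x. ennreal (F\<^sup>2 / 2) \<partial>P)"
    using P.emeasure_space_1 by simp
  also have "\<dots> \<le> (\<integral>\<^sup>+x. (?p x + ?m (flip K x)) + ennreal (F\<^sup>2 / 2) * (indicator A x + indicator A (flip K x)) \<partial>P)"
  proof (rule nn_integral_mono_AE, rule AE_mp[OF sym], rule AE_I2, rule impI)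
    fix x assume x: "x \<in> space P" and fl: "\<forall>j\<in>{1..K}. h (flip K x) j = h x j"
    have x: "x \<in> space seq_space" "flip K x \<in> space seq_space"
      using x measurable_space[OF measurable_flip] by (auto simp: P_def sp)
    show "ennreal (F\<^sup>2 / 2) \<le> (?p x + ?m (flip K x)) + ennreal (F\<^sup>2 / 2) * (indicator A x + indicator A (flip K x))"
    proof (cases "x \<in> A \<or> flip K x \<in> A")
      case True
      then have "(1 :: ennreal) \<le> indicator A x + indicator A (flip K x)"
        by (auto split: split_indicator)
      from mult_left_mono[OF this, of "ennreal (F\<^sup>2 / 2)"]
      show ?thesis by (simp add: add_increasing)
    next
      case False
      have near: "\<bar>?E y - (\<Sum>j<K. h y (Suc j))\<bar> \<le> F / 2"
        if "y \<in> space seq_space" "y \<notin> A" for y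
      proof (rule expansion_split[where \<psi> = \<psi> and t = t, OF \<psi>])
        have "ennreal (2 / F) * tail h K y \<le> 1" using that by (auto simp: A_def)
        then have "ennreal (F / 2) * (ennreal (2 / F) * tail h K y) \<le> ennreal (F / 2) * 1"
          by (rule mult_left_mono) simp
        then show "(\<Sum>j. ennreal \<bar>h y (Suc (K + j))\<bar>) \<le> ennreal (F / 2)"
          using F by (simp add: mult.assoc[symmetric] ennreal_mult[symmetric] tail_def)
      qed (use F in auto)
      have head: "(\<Sum>j<K. h (flip K x) (Suc j)) = (\<Sum>j<K. h x (Suc j))"
        using fl by (intro sum.cong) auto
      have "\<bar>?E x - (\<Sum>j<K. h x (Suc j))\<bar> \<le> F / 2" "\<bar>?E (flip K x) - (\<Sum>j<K. h x (Suc j))\<bar> \<le> F / 2"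
        using near[of x] near[of "flip K x"] False x by (simp_all add: head)
      then have gap: "(?E (flip K x) + F) - (?E x - F) \<ge> F"
        by linarith
      have "F\<^sup>2 \<le> ((?E (flip K x) + F) - (?E x - F))\<^sup>2"
        using gap F by (intro power_mono) auto
      also have "\<dots> \<le> 2 * ((?E x - F)\<^sup>2 + (?E (flip K x) + F)\<^sup>2)"
        using sum_squares_ge_zero[of "(?E (flip K x) + F) + (?E x - F)" 0]
        by (simp add: power2_eq_square algebra_simps)
      finally have "ennreal (F\<^sup>2 / 2) \<le> ?p x + ?m (flip K x)"
        by (simp add: ennreal_plus[symmetric] del: ennreal_plus)
      then show ?thesis by (simp add: add_increasing2)
    qed
  qed
  also have "\<dots> = ((\<integral>\<^sup>+x. ?p x \<partial>P) + (\<integral>\<^sup>+x. ?m (flip K x) \<partial>P))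
      + ennreal (F\<^sup>2 / 2) * (emeasure P A + emeasure (obs_law n (block n K (- 1))) A)"
    by (simp add: nn_integral_add nn_integral_cmult flip_A)
  also have "\<dots> \<le> (local_risk \<psi> n h (block n K 1) t + local_risk \<psi> n h (block n K (- 1)) t)
      + ennreal (F\<^sup>2 / 2) * (ennreal (1 / 4) + ennreal (1 / 4))"
    unfolding risk_plus risk_minus P_def by (intro add_left_mono mult_left_mono add_mono A1) auto
  also have "ennreal (F\<^sup>2 / 2) * (ennreal (1 / 4) + ennreal (1 / 4)) = ennreal (F\<^sup>2 / 2 * (1 / 4 + 1 / 4))"
  proof -
    have quarters: "ennreal (1 / 4) + ennreal (1 / 4) = ennreal (1 / 4 + 1 / 4)"
      by (rule ennreal_plus[symmetric]) simp_all
    show ?thesis unfolding quarters by (rule ennreal_mult[symmetric]) simp_all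
  qed
  also have "F\<^sup>2 / 2 * (1 / 4 + 1 / 4) = F\<^sup>2 / 4" by simp
  finally have "ennreal (F\<^sup>2 / 2)
      \<le> (local_risk \<psi> n h (block n K 1) t + local_risk \<psi> n h (block n K (- 1)) t) + ennreal (F\<^sup>2 / 4)" .
  then have "ennreal (F\<^sup>2 / 4) \<le> local_risk \<psi> n h (block n K 1) t + local_risk \<psi> n h (block n K (- 1)) t"
    by (cases "local_risk \<psi> n h (block n K 1) t + local_risk \<psi> n h (block n K (- 1)) t")
       (auto simp: ennreal_plus[symmetric] simp del: ennreal_plus)
  moreover have "F\<^sup>2 / 4 = (real K)\<^sup>2 / (4 * real n)"
    by (simp add: F_def power_divide)
  ultimately show ?thesis by simp
qed

section \<open>The rate\<close>

lemma ennreal_half_le: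
  assumes "ennreal (2 * a) \<le> S + S" shows "ennreal a \<le> S"
  using assms by (cases S) (auto simp: ennreal_plus[symmetric] simp del: ennreal_plus)

theorem proposition4:
  fixes lam \<tau>0 q \<beta> L0 t :: real
    and \<psi> :: "nat \<Rightarrow> real \<Rightarrow> real"
    and \<theta>hat :: "nat \<Rightarrow> (nat \<Rightarrow> real) \<Rightarrow> (nat \<Rightarrow> real)"
  assumes "lam > 0" and "\<tau>0 > 0" and "1/2 < q" and "q \<le> 1"
    and "\<And>n. n \<ge> 1 \<Longrightarrow> posterior_mean lam \<tau>0 q n (\<theta>hat n)"
    and "orthonormal_basis_L2 \<psi>"
    and "t \<in> {0..1}" and "\<And>j. j \<ge> 1 \<Longrightarrow> \<psi> j t = 1"
    and "\<beta> \<ge> q" and "L0 > 0"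
  shows "\<exists>c>0. \<forall>\<^sub>F n in sequentially.
           ennreal (c * (real n powr (- ((2 * \<beta> - 1) / (2 * \<beta> + 1))) / (ln (real n))\<^sup>2))
             \<le> (SUP \<theta>0\<in>sobolev \<beta> L0. local_risk \<psi> n (\<theta>hat n) \<theta>0 t)"
proof -
  define p where "p = 1 / (2 * \<beta> + 1)"
  \<comment> \<open>with \<open>K \<le> (d n)\<^sup>p\<close> the block has squared Sobolev norm at most \<open>L0 / 2\<close>\<close>
  define d where "d = L0 / 2 powr (2 * \<beta> + 1)"
  define D where "D = 32 * (sqrt \<tau>0 * exp (lam * exp 2))"
  have \<beta>: "\<beta> > 0" using assms(3,9) by linarith
  have p: "p > 0" and d: "d > 0" and D: "D > 0"
    using \<beta> assms(1,2,10) by (auto simp: p_def d_def D_def)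
  have ev: "\<forall>\<^sub>F n in sequentially. n \<ge> 3 \<and> (d * real n) powr p \<ge> 2
      \<and> D * sqrt (real n) \<le> exp ((d * real n) powr p - 1)"
  proof (intro eventually_conj eventually_ge_at_top)
    show "\<forall>\<^sub>F n in sequentially. (d * real n) powr p \<ge> 2"
      using p d by real_asymp
    show "\<forall>\<^sub>F n in sequentially. D * sqrt (real n) \<le> exp ((d * real n) powr p - 1)"
      using p d D by real_asymp
  qed
  have "\<forall>\<^sub>F n in sequentially.
      ennreal (d powr (2 * p) / 32 * (real n powr (- ((2 * \<beta> - 1) / (2 * \<beta> + 1))) / (ln (real n))\<^sup>2))
        \<le> (SUP \<theta>0\<in>sobolev \<beta> L0. local_risk \<psi> n (\<theta>hat n) \<theta>0 t)"
    using ev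
  proof eventually_elim
    case (elim n)
    define y where "y = (d * real n) powr p"
    define K where "K = nat \<lfloor>y\<rfloor>"
    have n: "n \<ge> 1" and y: "y \<ge> 2" and Dn: "D * sqrt (real n) \<le> exp (y - 1)"
      using elim by (auto simp: y_def)
    have K: "real K \<le> y" "y - 1 \<le> real K" "K \<ge> 1"
      using y unfolding K_def by linarith+
    let ?S = "SUP \<theta>0\<in>sobolev \<beta> L0. local_risk \<psi> n (\<theta>hat n) \<theta>0 t"
    have "real K * (2 * real K) powr (2 * \<beta>) \<le> y * (2 * y) powr (2 * \<beta>)"
      using K \<beta> by (intro mult_mono powr_mono2) auto
    also have "\<dots> = 2 powr (2 * \<beta>) * y powr (2 * \<beta> + 1)"
      using y by (simp add: powr_mult powr_add)
    also have "y powr (2 * \<beta> + 1) = d * real n"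
      using \<beta> d n by (simp add: y_def powr_powr p_def)
    also have "2 powr (2 * \<beta>) * (d * real n) = L0 / 2 * real n"
      by (simp add: d_def powr_add)
    also have "\<dots> < L0 * real n" using n assms(10) by simp
    finally have sob: "real K * (2 * real K) powr (2 * \<beta>) < L0 * real n" .
    have risk: "local_risk \<psi> n (\<theta>hat n) (block n K b) t \<le> ?S" if "b\<^sup>2 \<le> 1" for b
      by (intro SUP_upper block_in_sobolev that) (use \<beta> n sob in auto)
    have "D * sqrt (real n) \<le> exp (real K)"
      using Dn K(2) by (auto intro: order.trans)
    then have "ennreal ((real K)\<^sup>2 / (4 * real n))
        \<le> local_risk \<psi> n (\<theta>hat n) (block n K 1) t + local_risk \<psi> n (\<theta>hat n) (block n K (- 1)) t"
      using assms(1-3,5,8) n K by (intro local_risk_two_point[of lam \<tau>0 q]) (auto simp: D_def)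
    also have "\<dots> \<le> ?S + ?S" by (intro add_mono risk) auto
    finally have "ennreal (2 * ((real K)\<^sup>2 / (8 * real n))) \<le> ?S + ?S" by simp
    then have "ennreal ((real K)\<^sup>2 / (8 * real n)) \<le> ?S" by (rule ennreal_half_le)
    moreover have "d powr (2 * p) / 32 * (real n powr (- ((2 * \<beta> - 1) / (2 * \<beta> + 1))) / (ln (real n))\<^sup>2)
        \<le> (real K)\<^sup>2 / (8 * real n)"
    proof -
      have "exp 1 \<le> real n" using exp_le elim by linarith
      then have "1 \<le> ln (real n)" using n by (subst ln_ge_iff) auto
      then have ln: "1 \<le> (ln (real n))\<^sup>2" by simp
      have ex: "- ((2 * \<beta> - 1) / (2 * \<beta> + 1)) = 2 * p - 1"
        using \<beta> by (simp add: p_def field_simps)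
      have "d powr (2 * p) / 32 * (real n powr (2 * p - 1) / (ln (real n))\<^sup>2)
          \<le> d powr (2 * p) / 32 * (real n powr (2 * p - 1) / 1)"
        using ln by (intro mult_left_mono divide_left_mono) auto
      also have "\<dots> = y powr 2 / (32 * real n)"
        using d n by (simp add: y_def powr_powr powr_mult powr_diff mult.commute)
      also have "\<dots> = (y / 2)\<^sup>2 / (8 * real n)"
        using y by (simp add: power_divide)
      also have "\<dots> \<le> (real K)\<^sup>2 / (8 * real n)"
        using y K by (intro divide_right_mono power_mono) auto
      finally show ?thesis unfolding ex .
    qed
    ultimately show ?case by (meson ennreal_leI order.trans)
  qed
  moreover have "d powr (2 * p) / 32 > 0" using d by simp
  ultimately show ?thesis by blast
qed

end
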